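(* There is no nontrivial SLEMC $M$ such that every idempotent algebra having a Taylor term satisfies $M$.
   Context: An algebra $\mathbf A$ is a base set $A$ (possibly infinite) together with a set of basic operations $A^n\to A$ of finite arities $n$. The clone of operations of $\mathbf A$ is the smallest set of operations on $A$ that contains all basic operations and all projections $\pi^n_i(x_1,\dots,x_n)=x_i$ and is closed under composition; its members are called the operations of $\mathbf A$. The algebra $\mathbf A$ is idempotent if $t(a,\dots,a)=a$ for every operation $t$ of $\mathbf A$ and every $a\in A$. An identity $u\approx v$ holds in an algebra if the two sides are equal for every assignment of elements of the algebra to the variables. A (strong) Maltsev condition $M$ is a finite list of identities involving some operation symbols. An algebra $\mathbf A$ satisfies $M$ if to each $n$-ary operation symbol occurring in $M$ one can assign an $n$-ary operation of $\mathbf A$ (from its clone) so that all identities of $M$ become true in $\mathbf A$. The condition $M$ is trivial if it is satisfied by the algebra $\mathbf P$ on two elements $0,1$ whose set of operations consists of the projections only; otherwise it is nontrivial. The condition $M$ is linear if its identities do not involve compositions, i.e. each identity has the form $t(\overline x)\approx s(\overline y)$, or $t(\overline x)\approx z$, or $z\approx r$, where $\overline x,\overline y$ are tuples of variables (repetitions allowed), $t,s$ are (possibly equal) operation symbols, and $z,r$ are variables. A SLEMC (single linear equality Maltsev condition) is a linear Maltsev condition consisting of exactly one identity. An algebra has a Taylor term if it has an operation $t$, of some arity $n$, satisfying a system of identities of the following form: $t(x,\dots,x)\approx x$ and, for each $i=1,\dots,n$, an identity $t(u_{i,1},\dots,u_{i,n})\approx t(v_{i,1},\dots,v_{i,n})$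 where $x,y$ are distinct variables, all $u_{i,j},v_{i,j}\in\{x,y\}$, $u_{i,i}=x$ and $v_{i,i}=y$. *)

theory Defs
  imports Main "HOL-Library.FuncSet" "HOL-Library.NList"
begin

section \<open>Algebras and clones\<close>

text \<open>
  An \<open>n\<close>-ary operation on \<open>A\<close> is a function on the lists of length \<open>n\<close> over \<open>A\<close>, extensional outside
  that domain, so that equality of functions is equality of operations.
\<close>

definition operations :: "'a set \<Rightarrow> nat \<Rightarrow> ('a list \<Rightarrow> 'a) set" where
  "operations A n = nlists n A \<rightarrow>\<^sub>E A"

definition projection :: "'a set \<Rightarrow> nat \<Rightarrow> nat \<Rightarrow> 'a list \<Rightarrow> 'a" where
  "projection A n i = (\<lambda>xs\<in>nlists n A. xs ! i)"

definition composition ::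
  "'a set \<Rightarrow> nat \<Rightarrow> ('a list \<Rightarrow> 'a) \<Rightarrow> ('a list \<Rightarrow> 'a) list \<Rightarrow> 'a list \<Rightarrow> 'a" where
  "composition A k f gs = (\<lambda>xs\<in>nlists k A. f (map (\<lambda>g. g xs) gs))"

record 'a algebra =
  carrier :: "'a set"
  basic_ops :: "nat \<Rightarrow> ('a list \<Rightarrow> 'a) set"

definition is_algebra :: "'a algebra \<Rightarrow> bool" where
  "is_algebra \<A> \<longleftrightarrow>
     carrier \<A> \<noteq> {} \<and> (\<forall>n. basic_ops \<A> n \<subseteq> operations (carrier \<A>) n)"

inductive_set clone :: "'a algebra \<Rightarrow> (nat \<times> ('a list \<Rightarrow> 'a)) set" for \<A> where
  basic: "f \<in> basic_ops \<A> n \<Longrightarrow> (n, f) \<in> clone \<A>"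
| proj: "i < n \<Longrightarrow> (n, projection (carrier \<A>) n i) \<in> clone \<A>"
| comp: "(length gs, f) \<in> clone \<A> \<Longrightarrow> (\<And>g. g \<in> set gs \<Longrightarrow> (k, g) \<in> clone \<A>) \<Longrightarrow>
         (k, composition (carrier \<A>) k f gs) \<in> clone \<A>"

definition idempotent :: "'a algebra \<Rightarrow> bool" where
  "idempotent \<A> \<longleftrightarrow> (\<forall>(n, t) \<in> clone \<A>. \<forall>a \<in> carrier \<A>. t (replicate n a) = a)"

section \<open>Identities\<close>

datatype (funs: 'f, vars: 'v) trm = Var 'v | App 'f "('f, 'v) trm list"

primrec eval :: "('f \<Rightarrow> 'a list \<Rightarrow> 'a) \<Rightarrow> ('v \<Rightarrow> 'a) \<Rightarrow> ('f, 'v) trm \<Rightarrow> 'a" where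
  "eval I \<sigma> (Var x) = \<sigma> x"
| "eval I \<sigma> (App f ts) = I f (map (eval I \<sigma>) ts)"

type_synonym ('f, 'v) identity = "('f, 'v) trm \<times> ('f, 'v) trm"

definition holds :: "'a set \<Rightarrow> ('f \<Rightarrow> 'a list \<Rightarrow> 'a) \<Rightarrow> ('f, 'v) identity \<Rightarrow> bool" where
  "holds A I e \<longleftrightarrow> (\<forall>\<sigma>. range \<sigma> \<subseteq> A \<longrightarrow> eval I \<sigma> (fst e) = eval I \<sigma> (snd e))"

section \<open>Maltsev conditions\<close>

record ('f, 'v) maltsev =
  arity :: "'f \<Rightarrow> nat"
  identities :: "('f, 'v) identity list"

primrec wf_trm :: "('f \<Rightarrow> nat) \<Rightarrow> ('f, 'v) trm \<Rightarrow> bool" where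
  "wf_trm ar (Var x) \<longleftrightarrow> True"
| "wf_trm ar (App f ts) \<longleftrightarrow> length ts = ar f \<and> list_all (wf_trm ar) ts"

definition is_maltsev_condition :: "('f, 'v) maltsev \<Rightarrow> bool" where
  "is_maltsev_condition M \<longleftrightarrow>
     (\<forall>(l, r) \<in> set (identities M). wf_trm (arity M) l \<and> wf_trm (arity M) r)"

definition symbols :: "('f, 'v) maltsev \<Rightarrow> 'f set" where
  "symbols M = (\<Union>(l, r) \<in> set (identities M). funs l \<union> funs r)"

definition satisfies :: "'a algebra \<Rightarrow> ('f, 'v) maltsev \<Rightarrow> bool" where
  "satisfies \<A> M \<longleftrightarrow>
     (\<exists>I. (\<forall>f \<in> symbols M. (arity M f, I f) \<in> clone \<A>) \<and>
          (\<forall>e \<in> set (identities M). holds (carrier \<A>) I e))"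

definition projection_algebra :: "nat algebra" where
  "projection_algebra =
     \<lparr>carrier = {0, 1}, basic_ops = (\<lambda>n. {projection {0, 1} n i |i. i < n})\<rparr>"

definition trivial_condition :: "('f, 'v) maltsev \<Rightarrow> bool" where
  "trivial_condition M \<longleftrightarrow> satisfies projection_algebra M"

definition linear_trm :: "('f, 'v) trm \<Rightarrow> bool" where
  "linear_trm t \<longleftrightarrow> (\<exists>x. t = Var x) \<or> (\<exists>f xs. t = App f (map Var xs))"

definition linear_condition :: "('f, 'v) maltsev \<Rightarrow> bool" where
  "linear_condition M \<longleftrightarrow> (\<forall>(l, r) \<in> set (identities M). linear_trm l \<and> linear_trm r)"

definition slemc :: "('f, 'v) maltsev \<Rightarrow> bool" where
  "slemc M \<longleftrightarrow> is_maltsev_condition M \<and> linear_condition M \<and> length (identities M) = 1"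

section \<open>Taylor terms\<close>

datatype taylor_var = VX | VY

definition taylor_operation :: "'a set \<Rightarrow> nat \<Rightarrow> ('a list \<Rightarrow> 'a) \<Rightarrow> bool" where
  "taylor_operation A n t \<longleftrightarrow>
     holds A (\<lambda>_ :: unit. t) (App () (replicate n (Var VX)), Var VX) \<and>
     (\<forall>i < n. \<exists>us vs :: taylor_var list.
        length us = n \<and> length vs = n \<and> us ! i = VX \<and> vs ! i = VY \<and>
        holds A (\<lambda>_ :: unit. t) (App () (map Var us), App () (map Var vs)))"

definition has_taylor_term :: "'a algebra \<Rightarrow> bool" where
  "has_taylor_term \<A> \<longleftrightarrow> (\<exists>(n, t) \<in> clone \<A>. taylor_operation (carrier \<A>) n t)"

text \<open>
  HOL cannot quantify over all types inside a formula, so a statement about ``every algebra'' ranges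
  over the algebras whose carrier is a nonempty subset of some type \<open>'a\<close>. Below, such a
  statement occurs negatively: it is refuted for each infinite \<open>'a\<close> separately. (For finite \<open>'a\<close>
  the range would omit all infinite algebras.)
\<close>

end

theory Submission
  imports Defs "HOL-Library.Countable"
begin

text \<open>
  An identity between linear terms with different head symbols, or with a variable on one side, is
  either satisfied by projections or forces an idempotent algebra to have one element. The
  remaining identities are \<open>t(x\<^sub>1,\<dots>,x\<^sub>n) \<approx> t(y\<^sub>1,\<dots>,y\<^sub>n)\<close> with \<open>x\<^sub>i \<noteq> y\<^sub>i\<close> for all \<open>i\<close>. Such an identity
  fails in every algebra that has a compatible irreflexive binary relation containing all pairs of
  distinct elements of an infinite set: applying \<open>t\<close> to the pairs \<open>(x\<^sub>i, y\<^sub>i)\<close> would produce a loop.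

  We take ternary trees with leaves labelled by natural numbers and the ternary weak near-unanimity
  operation that builds a node up to the identities \<open>w(x,x,x) \<approx> x\<close> and
  \<open>w(x,x,y) \<approx> w(x,y,x) \<approx> w(y,x,x)\<close>. In the relation generated by the pairs of distinct leaves, related
  trees are never subtrees of each other, so there is no loop.
\<close>

section \<open>Clones\<close>

lemma clone_idempotent:
  assumes basic_idem: "\<And>n f a. \<lbrakk>f \<in> basic_ops \<A> n; a \<in> carrier \<A>\<rbrakk> \<Longrightarrow> f (replicate n a) = a"
  shows "idempotent \<A>"
proof -
  have "t (replicate n a) = a" if "(n, t) \<in> clone \<A>" and a: "a \<in> carrier \<A>" for n t a
  proof -
    have const: "replicate k a \<in> nlists k (carrier \<A>)" for k
      using a by (intro nlistsI) auto
    show ?thesis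
      using that(1)
    proof (induction n t rule: clone.induct)
      case (basic f n)
      then show ?case using basic_idem a by blast
    next
      case (proj i n)
      then show ?case using const by (simp add: projection_def)
    next
      case (comp gs f k)
      have "map (\<lambda>g. g (replicate k a)) gs = replicate (length gs) a"
        using comp.IH(2) by (intro replicate_eqI) auto
      with comp.IH(1) show ?case using const by (simp add: composition_def)
    qed
  qed
  then show ?thesis by (auto simp: idempotent_def)
qed

lemma list_all2_nlists:
  assumes "list_all2 R xs ys" "\<And>x y. R x y \<Longrightarrow> x \<in> A \<and> y \<in> A" "length xs = n"
  shows "xs \<in> nlists n A" "ys \<in> nlists n A"
proof -
  have "set xs \<subseteq> A \<and> set ys \<subseteq> A"
    using assms(1,2) by (induction rule: list_all2_induct) auto
  then show "xs \<in> nlists n A" "ys \<in> nlists n A"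
    using list_all2_lengthD[OF assms(1)] assms(3) by (auto intro!: nlistsI)
qed

text \<open>Confining \<open>R\<close> to the carrier keeps related lists in the domain where
  projections and compositions unfold; elsewhere these are \<open>undefined\<close>.\<close>

lemma clone_preserves:
  assumes R: "\<And>x y. R x y \<Longrightarrow> x \<in> carrier \<A> \<and> y \<in> carrier \<A>"
    and basic_preserves:
      "\<And>n f xs ys. \<lbrakk>f \<in> basic_ops \<A> n; length xs = n; list_all2 R xs ys\<rbrakk> \<Longrightarrow> R (f xs) (f ys)"
    and "(n, t) \<in> clone \<A>" "length xs = n" "list_all2 R xs ys"
  shows "R (t xs) (t ys)"
  using assms(3-)
proof (induction n t arbitrary: xs ys rule: clone.induct)
  case (basic f n)
  then show ?case using basic_preserves by blast
next
  case (proj i n)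
  note mem = list_all2_nlists[OF proj.prems(2) R proj.prems(1)]
  show ?case
    using mem list_all2_nthD[OF proj.prems(2), of i] proj by (simp add: projection_def)
next
  case (comp gs f k)
  note mem = list_all2_nlists[OF comp.prems(2) R comp.prems(1)]
  have "list_all2 R (map (\<lambda>g. g xs) gs) (map (\<lambda>g. g ys) gs)"
    using comp.IH(2) comp.prems by (simp add: list_all2_conv_all_nth)
  then have "R (f (map (\<lambda>g. g xs) gs)) (f (map (\<lambda>g. g ys) gs))"
    by (intro comp.IH(1)) simp_all
  then show ?case
    using mem by (simp add: composition_def)
qed

section \<open>Single linear identities\<close>

lemma projection_in_clone:
  assumes "i < n"
  shows "(n, projection {0, 1} n i) \<in> clone projection_algebra"
  using clone.proj[OF assms, of projection_algebra] by (simp add: projection_algebra_def)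

text \<open>Satisfaction in \<open>\<A>\<close> would force enough agreement between the two sides
  for projections to satisfy the identity too: idempotence yields a common variable, and
  \<open>R\<close> yields a common position when the head symbols agree.\<close>

lemma nontrivial_slemc_fails:
  fixes M :: "('f, 'v) maltsev" and \<A> :: "'a algebra"
  assumes idem: "idempotent \<A>"
    and R: "\<And>n t xs ys. \<lbrakk>(n, t) \<in> clone \<A>; length xs = n; list_all2 R xs ys\<rbrakk> \<Longrightarrow> R (t xs) (t ys)"
    and irrefl: "\<And>x. \<not> R x x"
    and c: "range c \<subseteq> carrier \<A>" "\<And>i j :: nat. i \<noteq> j \<Longrightarrow> R (c i) (c j)"
    and M: "slemc M" "\<not> trivial_condition M"
  shows "\<not> satisfies \<A> M"
proof
  assume "satisfies \<A> M"
  then obtain I where clone: "\<And>f. f \<in> symbols M \<Longrightarrow> (arity M f, I f) \<in> clone \<A>"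
    and hol: "\<And>e. e \<in> set (identities M) \<Longrightarrow> holds (carrier \<A>) I e"
    by (auto simp: satisfies_def)
  obtain l r where lr: "identities M = [(l, r)]"
    using M(1) by (auto simp: slemc_def length_Suc_conv)
  have wf: "wf_trm (arity M) l" "wf_trm (arity M) r" and lin: "linear_trm l" "linear_trm r"
    using M(1) lr by (auto simp: slemc_def is_maltsev_condition_def linear_condition_def)
  have sym: "symbols M = funs l \<union> funs r"
    by (simp add: symbols_def lr)
  have eq: "eval I \<sigma> l = eval I \<sigma> r" if "range \<sigma> \<subseteq> carrier \<A>" for \<sigma>
    using hol[of "(l, r)"] that by (simp add: lr holds_def)
  have eval_const: "eval I \<sigma> t = a"
    if "t \<in> {l, r}" "\<And>x. x \<in> vars t \<Longrightarrow> \<sigma> x = a" "a \<in> carrier \<A>" for t \<sigma> a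
  proof -
    have "linear_trm t" "wf_trm (arity M) t" "funs t \<subseteq> symbols M"
      using that(1) lin wf sym by auto
    then consider x where "t = Var x"
      | f xs where "t = App f (map Var xs)" "length xs = arity M f" "f \<in> symbols M"
      by (auto simp: linear_trm_def)
    then show ?thesis
    proof cases
      case 1
      then show ?thesis using that by simp
    next
      case 2
      then have "map (eval I \<sigma>) (map Var xs) = replicate (arity M f) a"
        using that(2) by (auto intro!: replicate_eqI)
      then show ?thesis
        using clone[OF 2(3)] idem that(3) 2(1) by (auto simp: idempotent_def)
    qed
  qed
  have "c 0 \<noteq> c 1"
    using c(2)[of 0 1] irrefl by auto
  have common: "vars l \<inter> vars r \<noteq> {}"
  proof
    assume "vars l \<inter> vars r = {}"
    \<comment> \<open>Constant on each side, this assignment lets idempotence evaluate the sides to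
      two different elements.\<close>
    then have "eval I (\<lambda>x. if x \<in> vars l then c 0 else c 1) l = c 0"
      "eval I (\<lambda>x. if x \<in> vars l then c 0 else c 1) r = c 1"
      using c(1) by (auto intro!: eval_const)
    then show False
      using eq[of "\<lambda>x. if x \<in> vars l then c 0 else c 1"] c(1) \<open>c 0 \<noteq> c 1\<close>
      by (auto simp: image_subset_iff)
  qed
  have matched: "\<exists>i < length xs. xs ! i = ys ! i"
    if l: "l = App f (map Var xs)" and r: "r = App f (map Var ys)" for f xs ys
  proof (rule ccontr)
    assume neq: "\<not> ?thesis"
    have len: "length xs = arity M f" "length ys = arity M f"
      using wf l r by auto
    \<comment> \<open>Numbering the variables injectively sends distinct ones to
      \<open>R\<close>-related elements. Without a matching position, compatibility then relates the
      common value of both sides to itself.\<close>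
    obtain h :: "'v \<Rightarrow> nat" where h: "inj_on h (set xs \<union> set ys)"
      using finite_imp_inj_to_nat_seg[of "set xs \<union> set ys"] by auto
    have "list_all2 R (map (c \<circ> h) xs) (map (c \<circ> h) ys)"
      using neq len c(2) h by (auto simp: list_all2_conv_all_nth inj_on_eq_iff)
    then have "R (I f (map (c \<circ> h) xs)) (I f (map (c \<circ> h) ys))"
      using R clone[of f] len by (simp add: sym l)
    moreover have "I f (map (c \<circ> h) xs) = I f (map (c \<circ> h) ys)"
      using eq[of "c \<circ> h"] c(1) by (auto simp: l r o_def)
    ultimately show False using irrefl by simp
  qed
  \<comment> \<open>Triviality reduces to choosing, by \<open>p\<close>, a place for each symbol to
    project to.\<close>
  define J where "J p f = projection {0, 1 :: nat} (arity M f) (p f)" for p f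
  have trivial: "trivial_condition M"
    if p: "\<And>f. f \<in> symbols M \<Longrightarrow> p f < arity M f"
      and J: "\<And>\<sigma>. range \<sigma> \<subseteq> {0, 1} \<Longrightarrow> eval (J p) \<sigma> l = eval (J p) \<sigma> r" for p
  proof -
    have "(arity M f, J p f) \<in> clone projection_algebra" if "f \<in> symbols M" for f
      using projection_in_clone p[OF that] by (simp add: J_def)
    moreover have "holds (carrier projection_algebra) (J p) (l, r)"
      using J unfolding holds_def projection_algebra_def by simp
    ultimately show ?thesis
      by (auto simp: trivial_condition_def satisfies_def lr)
  qed
  have eval_J: "eval (J p) \<sigma> (App f (map Var xs)) = \<sigma> (xs ! p f)"
    if "range \<sigma> \<subseteq> {0, 1}" "p f < length xs" "length xs = arity M f"
    for p f xs and \<sigma> :: "'v \<Rightarrow> nat"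
  proof -
    have "map \<sigma> xs \<in> nlists (arity M f) {0, 1}"
      using that(1,3) by (intro nlistsI) (auto simp: image_subset_iff)
    then have "J p f (map \<sigma> xs) = map \<sigma> xs ! p f"
      by (simp only: J_def projection_def restrict_apply if_True)
    moreover have "map (eval (J p) \<sigma>) (map Var xs) = map \<sigma> xs"
      by simp
    ultimately show ?thesis
      by (simp only: eval.simps nth_map[OF that(2)])
  qed
  \<comment> \<open>Unless the sides share a head symbol, each of them can be projected to this
    variable.\<close>
  obtain z where z: "z \<in> vars l" "z \<in> vars r"
    using common by blast
  have pos: "\<exists>i < arity M f. xs ! i = z"
    if "App f (map Var xs) \<in> {l, r}" for f xs
  proof -
    have "z \<in> set xs" "length xs = arity M f"
      using that z wf by auto
    then show ?thesis
      by (metis in_set_conv_nth)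
  qed
  consider x y where "l = Var x" "r = Var y"
    | x f ys where "l = Var x" "r = App f (map Var ys)"
    | f xs y where "l = App f (map Var xs)" "r = Var y"
    | f xs ys where "l = App f (map Var xs)" "r = App f (map Var ys)"
    | f xs g ys where "l = App f (map Var xs)" "r = App g (map Var ys)" "f \<noteq> g"
    using lin unfolding linear_trm_def by metis
  then have "trivial_condition M"
  proof cases
    case (1 x y)
    then show ?thesis using z sym by (intro trivial) auto
  next
    case (2 x f ys)
    with pos obtain i where i: "i < arity M f" "ys ! i = z" by blast
    have "eval (J (\<lambda>_. i)) \<sigma> l = eval (J (\<lambda>_. i)) \<sigma> r" if "range \<sigma> \<subseteq> {0, 1}" for \<sigma>
      using 2 i z wf eval_J[OF that, of "\<lambda>_. i" f ys] by simp
    with 2 i show ?thesis by (intro trivial) (auto simp: sym)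
  next
    case (3 f xs y)
    with pos obtain i where i: "i < arity M f" "xs ! i = z" by blast
    have "eval (J (\<lambda>_. i)) \<sigma> l = eval (J (\<lambda>_. i)) \<sigma> r" if "range \<sigma> \<subseteq> {0, 1}" for \<sigma>
      using 3 i z wf eval_J[OF that, of "\<lambda>_. i" f xs] by simp
    with 3 i show ?thesis by (intro trivial) (auto simp: sym)
  next
    case (4 f xs ys)
    \<comment> \<open>One place must serve both sides here, so a variable common to them at
      different places would not suffice.\<close>
    with matched obtain i where i: "i < length xs" "xs ! i = ys ! i" by blast
    have "eval (J (\<lambda>_. i)) \<sigma> l = eval (J (\<lambda>_. i)) \<sigma> r" if "range \<sigma> \<subseteq> {0, 1}" for \<sigma>
      using 4 i wf eval_J[OF that, of "\<lambda>_. i" f xs] eval_J[OF that, of "\<lambda>_. i" f ys] by simp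
    with 4 i wf show ?thesis by (intro trivial) (auto simp: sym)
  next
    case (5 f xs g ys)
    obtain i where i: "i < arity M f" "xs ! i = z"
      using pos[of f xs] 5 by auto
    obtain j where j: "j < arity M g" "ys ! j = z"
      using pos[of g ys] 5 by auto
    \<comment> \<open>Since \<open>f \<noteq> g\<close>, the places are chosen independently; the
      default \<open>j\<close> matters only for \<open>g\<close>.\<close>
    define p where "p h = (if h = f then i else j)" for h
    have p: "p f = i" "p g = j"
      using 5 by (auto simp: p_def)
    have "eval (J p) \<sigma> l = eval (J p) \<sigma> r" if "range \<sigma> \<subseteq> {0, 1}" for \<sigma>
      using 5 i j p wf eval_J[OF that, of p f xs] eval_J[OF that, of p g ys] by simp
    with 5 i j p show ?thesis by (intro trivial[of p]) (auto simp: sym)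
  qed
  with M(2) show False by contradiction
qed

section \<open>The weak near-unanimity algebra of trees\<close>

datatype tree = Leaf nat | Node tree tree tree

instance tree :: countable
  by countable_datatype

text \<open>A normal form for the weak near-unanimity identities: a repeated argument moves to the
  first two places, and three equal arguments collapse.\<close>

definition wnu :: "tree \<Rightarrow> tree \<Rightarrow> tree \<Rightarrow> tree" where
  "wnu a b c =
    (if a = b then if b = c then a else Node a a c
     else if a = c then Node a a b
     else if b = c then Node b b a
     else Node a b c)"

lemma wnu_idempotent: "wnu a a a = a"
  by (simp add: wnu_def)

lemma wnu_near_unanimity: "wnu x y x = wnu x x y" "wnu y x x = wnu x x y"
  by (simp_all add: wnu_def)

primrec subtree :: "tree \<Rightarrow> tree \<Rightarrow> bool" where
  "subtree s (Leaf i) \<longleftrightarrow> s = Leaf i"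
| "subtree s (Node a b c) \<longleftrightarrow> s = Node a b c \<or> subtree s a \<or> subtree s b \<or> subtree s c"

lemma subtree_refl: "subtree s s"
  by (cases s) auto

lemma subtree_trans: "subtree r s \<Longrightarrow> subtree s t \<Longrightarrow> subtree r t"
  by (induction t) auto

lemma subtree_wnu: "subtree a (wnu a b c)" "subtree b (wnu a b c)" "subtree c (wnu a b c)"
  by (auto simp: wnu_def subtree_refl)

lemma subtree_wnuE:
  assumes "subtree s (wnu a b c)"
  obtains "s = wnu a b c" | "subtree s a" | "subtree s b" | "subtree s c"
  using assms by (auto simp: wnu_def split: if_splits)

text \<open>If both sides have arguments of the shape \<open>x, x, y\<close> in some order, then \<open>x\<close> fills two of
  the three places on each side, so some place carries \<open>x\<close> on both.\<close>

lemma wnu_eq_cases: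
  assumes "wnu a b c = wnu a' b' c'"
  shows "a = a' \<or> b = b' \<or> c = c' \<or> a = wnu a' b' c' \<or> a' = wnu a b c"
  using assms
  \<comment> \<open>The last two alternatives cover three equal arguments on one side, where
    \<open>wnu\<close> returns that argument.\<close>
  by (cases "a = b"; cases "b = c"; cases "a = c"; cases "a' = b'"; cases "b' = c'"; cases "a' = c'")
    (simp_all add: wnu_def)

section \<open>The compatible irreflexive relation on trees\<close>

inductive edge :: "tree \<Rightarrow> tree \<Rightarrow> bool" where
  leaves: "i \<noteq> j \<Longrightarrow> edge (Leaf i) (Leaf j)"
| wnu: "edge a a' \<Longrightarrow> edge b b' \<Longrightarrow> edge c c' \<Longrightarrow> edge (wnu a b c) (wnu a' b' c')"

text \<open>If the left tree occurred inside \<open>a'\<close>, \<open>b'\<close> or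
  \<open>c'\<close>, it would bring along all its own arguments, among them the corresponding one of
  \<open>a\<close>, \<open>b\<close>, \<open>c\<close>.\<close>

lemma wnu_not_subtree:
  assumes "wnu a b c \<noteq> wnu a' b' c'"
    and "\<not> subtree a a'" "\<not> subtree b b'" "\<not> subtree c c'"
  shows "\<not> subtree (wnu a b c) (wnu a' b' c')"
proof
  assume "subtree (wnu a b c) (wnu a' b' c')"
  then show False
    using assms subtree_trans[OF subtree_wnu(1)] subtree_trans[OF subtree_wnu(2)]
      subtree_trans[OF subtree_wnu(3)]
    by (elim subtree_wnuE) blast+
qed

text \<open>Irreflexivity alone is too weak for the induction: equal values of \<open>wnu\<close>
  may come from \<open>a = wnu a' b' c'\<close>, excluded because \<open>a'\<close> would be a
  subtree of \<open>a\<close>.\<close>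

lemma edge_incomparable: "edge s t \<Longrightarrow> \<not> subtree s t \<and> \<not> subtree t s"
proof (induction rule: edge.induct)
  case (leaves i j)
  then show ?case by simp
next
  case (wnu a a' b b' c c')
  have "wnu a b c \<noteq> wnu a' b' c'"
  proof
    assume eq: "wnu a b c = wnu a' b' c'"
    then consider "a = a' \<or> b = b' \<or> c = c'" | "a = wnu a' b' c'" | "a' = wnu a b c"
      using wnu_eq_cases by blast
    then show False
    proof cases
      case 1
      then show ?thesis using wnu.IH subtree_refl by auto
    next
      case 2
      then show ?thesis using wnu.IH(1) subtree_wnu(1)[of a' b' c'] by simp
    next
      case 3
      then show ?thesis using wnu.IH(1) subtree_wnu(1)[of a b c] by simp
    qed
  qed
  with wnu.IH show ?case by (simp add: wnu_not_subtree)
qed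

lemma edge_irrefl: "\<not> edge s s"
  using edge_incomparable subtree_refl by blast

section \<open>Transport of the tree algebra along an injection\<close>

definition tree_op :: "(tree \<Rightarrow> 'a) \<Rightarrow> 'a list \<Rightarrow> 'a" where
  "tree_op e = (\<lambda>xs\<in>nlists 3 (range e).
     e (wnu (inv e (xs ! 0)) (inv e (xs ! 1)) (inv e (xs ! 2))))"

definition tree_algebra :: "(tree \<Rightarrow> 'a) \<Rightarrow> 'a algebra" where
  "tree_algebra e = \<lparr>carrier = range e, basic_ops = (\<lambda>n. if n = 3 then {tree_op e} else {})\<rparr>"

definition tree_edge :: "(tree \<Rightarrow> 'a) \<Rightarrow> 'a \<Rightarrow> 'a \<Rightarrow> bool" where
  "tree_edge e x y \<longleftrightarrow> (\<exists>s t. x = e s \<and> y = e t \<and> edge s t)"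

lemma tree_op_eq:
  assumes "inj e"
  shows "tree_op e [e a, e b, e c] = e (wnu a b c)"
proof -
  have "[e a, e b, e c] \<in> nlists 3 (range e)"
    by (intro nlistsI) auto
  then show ?thesis
    using assms by (simp add: tree_op_def)
qed

lemma is_algebra_tree_algebra: "is_algebra (tree_algebra e)"
proof -
  have "tree_op e \<in> operations (range e) 3"
    unfolding tree_op_def operations_def by (rule restrict_PiE[THEN iffD2]) auto
  then show ?thesis
    by (simp add: is_algebra_def tree_algebra_def)
qed

lemma idempotent_tree_algebra:
  assumes "inj e"
  shows "idempotent (tree_algebra e)"
  using assms
  by (intro clone_idempotent)
    (auto simp: tree_algebra_def numeral_3_eq_3 tree_op_eq wnu_idempotent split: if_splits)

lemma has_taylor_term_tree_algebra:
  assumes "inj e"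
  shows "has_taylor_term (tree_algebra e)"
proof -
  have clone: "(3, tree_op e) \<in> clone (tree_algebra e)"
    by (rule clone.basic) (simp add: tree_algebra_def)
  have idem: "tree_op e [x, x, x] = x" if "x \<in> range e" for x
    using that by (auto simp: tree_op_eq[OF assms] wnu_idempotent)
  have near: "tree_op e [x, y, x] = tree_op e [x, x, y]" "tree_op e [y, x, x] = tree_op e [x, x, y]"
    if "x \<in> range e" "y \<in> range e" for x y
    using that by (auto simp: tree_op_eq[OF assms] wnu_near_unanimity)
  have "\<exists>us vs. length us = 3 \<and> length vs = 3 \<and> us ! i = VX \<and> vs ! i = VY \<and>
      holds (range e) (\<lambda>_ :: unit. tree_op e) (App () (map Var us), App () (map Var vs))"
    if "i < 3" for i
  proof -
    \<comment> \<open>Each witness pair is an equation among \<open>w(x,x,y)\<close>,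
      \<open>w(x,y,x)\<close>, \<open>w(y,x,x)\<close> whose sides carry \<open>x\<close> and
      \<open>y\<close>, in this order, at place \<open>i\<close>.\<close>
    consider "i = 0" | "i = 1" | "i = 2" using \<open>i < 3\<close> by linarith
    then show ?thesis
    proof cases
      case 1
      show ?thesis
        by (rule exI[of _ "[VX, VX, VY]"], rule exI[of _ "[VY, VX, VX]"])
          (use 1 in \<open>simp add: holds_def image_subset_iff near\<close>)
    next
      case 2
      show ?thesis
        by (rule exI[of _ "[VX, VX, VY]"], rule exI[of _ "[VX, VY, VX]"])
          (use 2 in \<open>simp add: holds_def image_subset_iff near\<close>)
    next
      case 3
      show ?thesis
        by (rule exI[of _ "[VX, VY, VX]"], rule exI[of _ "[VX, VX, VY]"])
          (use 3 in \<open>simp add: holds_def image_subset_iff near\<close>)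
    qed
  qed
  moreover have "holds (range e) (\<lambda>_ :: unit. tree_op e) (App () (replicate 3 (Var VX)), Var VX)"
    by (simp add: holds_def numeral_3_eq_3 image_subset_iff idem)
  ultimately have "taylor_operation (carrier (tree_algebra e)) 3 (tree_op e)"
    by (simp add: taylor_operation_def tree_algebra_def)
  with clone show ?thesis
    unfolding has_taylor_term_def by blast
qed

lemma tree_op_preserves_edge:
  assumes "inj e" "length xs = 3" "list_all2 (tree_edge e) xs ys"
  shows "tree_edge e (tree_op e xs) (tree_op e ys)"
proof -
  obtain x1 x2 x3 where "xs = [x1, x2, x3]"
    using assms(2) by (auto simp: numeral_3_eq_3 length_Suc_conv)
  with assms(3) obtain s1 s2 s3 t1 t2 t3 where
    "xs = [e s1, e s2, e s3]" "ys = [e t1, e t2, e t3]" "edge s1 t1" "edge s2 t2" "edge s3 t3"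
    by (auto simp: list_all2_Cons1 tree_edge_def)
  then show ?thesis
    by (auto simp: tree_op_eq[OF assms(1)] tree_edge_def intro: edge.wnu)
qed

theorem mainTheorem2:
  assumes "infinite (UNIV :: 'a set)"
  shows "\<not> (\<exists>M :: ('f, 'v) maltsev. slemc M \<and> \<not> trivial_condition M \<and>
    (\<forall>\<A> :: 'a algebra. is_algebra \<A> \<and> idempotent \<A> \<and> has_taylor_term \<A> \<longrightarrow> satisfies \<A> M))"
proof -
  obtain f :: "nat \<Rightarrow> 'a" where "inj f"
    using infinite_countable_subset[OF assms] by auto
  \<comment> \<open>Trees are countable and an infinite type contains a copy of the naturals, so the
    tree algebra fits into \<open>'a\<close>.\<close>
  define e where "e = f \<circ> (to_nat :: tree \<Rightarrow> nat)"
  have e: "inj e"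
    unfolding e_def using \<open>inj f\<close> by (intro inj_compose) auto
  have "\<not> satisfies (tree_algebra e) M" if "slemc M" "\<not> trivial_condition M"
    for M :: "('f, 'v) maltsev"
  proof (rule nontrivial_slemc_fails[where R = "tree_edge e" and c = "e \<circ> Leaf"])
    show "tree_edge e (t xs) (t ys)"
      if "(n, t) \<in> clone (tree_algebra e)" "length xs = n" "list_all2 (tree_edge e) xs ys" for n t xs ys
      by (rule clone_preserves[OF _ _ that])
        (auto simp: tree_algebra_def tree_op_preserves_edge[OF e] split: if_splits,
          auto simp: tree_edge_def)
    show "\<not> tree_edge e x x" for x
      using edge_irrefl e by (auto simp: tree_edge_def inj_eq)
    show "tree_edge e ((e \<circ> Leaf) i) ((e \<circ> Leaf) j)" if "i \<noteq> j" for i j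
      using that by (auto simp: tree_edge_def intro: edge.leaves)
  qed (use that idempotent_tree_algebra[OF e] in \<open>auto simp: tree_algebra_def\<close>)
  then show ?thesis
    using is_algebra_tree_algebra idempotent_tree_algebra[OF e] has_taylor_term_tree_algebra[OF e]
    by blast
qed

end
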